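(* The group $M_K$ is isomorphic to the Coxeter group $W(D_6)$. Under this isomorphism, the generators $(23)_S,(34)_S,(45)_S,(56)_S,(67)_S$, and $(12)$ of $M_K$ correspond respectively to the elements $s_1,s_2,s_3,s_4,s_5,s_1s_2s_{1'}s_2s_1$ of $W(D_6)$.
   Context: For $i<j$ let $(ij)$ denote the $7\times7$ permutation matrix interchanging coordinates $i$ and $j$ of $\mathbb{C}^7$. Let $S\in GL(7,\mathbb{R})$ be the matrix with rows $(1,0,0,0,0,0,0)$, $(0,0,1,1,0,0,0)$, $(0,1,0,1,0,0,0)$, $(0,1,1,0,0,0,0)$, $(0,1,1,1,1,0,0)$, $(0,1,1,1,0,1,0)$, $(0,1,1,1,0,0,1)$, and write $(ij)_S=S(ij)S^{-1}$. Let $P_{1,6}$ be the group of $7\times7$ permutation matrices fixing the first coordinate, $G_K=SP_{1,6}S^{-1}$, and let $M_K$ be the subgroup of $GL(7,\mathbb{R})$ generated by $G_K$ and the matrix $(12)$. The Dynkin diagram of type $D_6$ is the graph with vertices $1',1,2,3,4,5$ in which $i,j\in\{1,\dots,5\}$ are adjacent iff $|i-j|=1$, and $1'$ is adjacent only to $2$. Set $m(i,j)=1$ if $i=j$, $2$ if $i\neq j$ are not adjacent, $3$ if adjacent. $W(D_6)=\langle s_{1'},s_1,s_2,s_3,s_4,s_5\mid (s_is_j)^{m(i,j)}=1\rangle$. *)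

theory Defs
  imports "HOL-Analysis.Analysis" "HOL-Algebra.Generated_Groups"
begin

section \<open>Matrix groups\<close>

definition GL :: "(real ^ 'n ^ 'n) monoid" where
  "GL = \<lparr>carrier = {A. invertible A}, mult = (**), one = mat 1\<rparr>"

text \<open>The matrix sending basis vector number \<open>c\<close> to basis vector number \<open>\<sigma> c\<close>.\<close>

definition perm_matrix :: "('n \<Rightarrow> 'n) \<Rightarrow> real ^ 'n ^ 'n" where
  "perm_matrix \<sigma> = (\<chi> r c. if r = \<sigma> c then 1 else 0)"

text \<open>Coordinates are indexed by the seven-element numeral type \<open>7\<close>, with elements \<open>1, \<dots>, 7\<close>.
  In that type \<open>7 = 0\<close>, so its order is not the usual one on \<open>1, \<dots>, 7\<close>; the order is not used.\<close>

definition swap_matrix :: "7 \<Rightarrow> 7 \<Rightarrow> real ^ 7 ^ 7" where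
  "swap_matrix i j = perm_matrix (Transposition.transpose i j)"

definition S_mat :: "real ^ 7 ^ 7" where
  "S_mat = vector
    [vector [1, 0, 0, 0, 0, 0, 0],
     vector [0, 0, 1, 1, 0, 0, 0],
     vector [0, 1, 0, 1, 0, 0, 0],
     vector [0, 1, 1, 0, 0, 0, 0],
     vector [0, 1, 1, 1, 1, 0, 0],
     vector [0, 1, 1, 1, 0, 1, 0],
     vector [0, 1, 1, 1, 0, 0, 1]]"

definition conj_S :: "real ^ 7 ^ 7 \<Rightarrow> real ^ 7 ^ 7" where
  "conj_S A = S_mat ** A ** matrix_inv S_mat"

definition swap_S :: "7 \<Rightarrow> 7 \<Rightarrow> real ^ 7 ^ 7" where
  "swap_S i j = conj_S (swap_matrix i j)"

definition P_1_6 :: "(real ^ 7 ^ 7) set" where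
  "P_1_6 = {perm_matrix \<sigma> | \<sigma>. bij \<sigma> \<and> \<sigma> 1 = 1}"

definition G_K :: "(real ^ 7 ^ 7) set" where
  "G_K = conj_S ` P_1_6"

definition M_K :: "(real ^ 7 ^ 7) set" where
  "M_K = generate GL (G_K \<union> {swap_matrix 1 2})"

section \<open>Groups given by generators and relators\<close>

text \<open>A word is a list of letters \<open>(x, b)\<close>, where \<open>(x, True)\<close> stands for the generator \<open>x\<close> and
  \<open>(x, False)\<close> for its formal inverse. Two words represent the same element of the presented
  group iff they are related by insertions and deletions of relators and of pairs of mutually
  inverse letters.\<close>

type_synonym 'a word = "('a \<times> bool) list"

inductive word_eq :: "'a word set \<Rightarrow> 'a word \<Rightarrow> 'a word \<Rightarrow> bool" for R where
  refl: "word_eq R u u"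
| sym: "word_eq R u v \<Longrightarrow> word_eq R v u"
| trans: "word_eq R u v \<Longrightarrow> word_eq R v w \<Longrightarrow> word_eq R u w"
| cancel: "word_eq R (u @ [(x, b), (x, \<not> b)] @ v) (u @ v)"
| relator: "r \<in> R \<Longrightarrow> word_eq R (u @ r @ v) (u @ v)"

definition word_class :: "'a word set \<Rightarrow> 'a word \<Rightarrow> 'a word set" where
  "word_class R u = {v. word_eq R u v}"

text \<open>All elements of the type \<open>'a\<close> are generators.\<close>

definition presented_group :: "'a word set \<Rightarrow> 'a word set monoid" where
  "presented_group R =
    \<lparr>carrier = range (word_class R),
     mult = (\<lambda>A B. \<Union>a\<in>A. \<Union>b\<in>B. word_class R (a @ b)),
     one = word_class R []\<rparr>"

definition coxeter_relators :: "('a \<Rightarrow> 'a \<Rightarrow> nat) \<Rightarrow> 'a word set" where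
  "coxeter_relators m = {concat (replicate (m i j) [(i, True), (j, True)]) | i j. True}"

definition coxeter_group :: "('a \<Rightarrow> 'a \<Rightarrow> nat) \<Rightarrow> 'a word set monoid" where
  "coxeter_group m = presented_group (coxeter_relators m)"

definition coxeter_gen :: "('a \<Rightarrow> 'a \<Rightarrow> nat) \<Rightarrow> 'a \<Rightarrow> 'a word set" where
  "coxeter_gen m i = word_class (coxeter_relators m) [(i, True)]"

section \<open>The Coxeter group of type \<open>D\<^sub>6\<close>\<close>

text \<open>\<open>V1'\<close> is the vertex written \<open>1'\<close>.\<close>

datatype D6_vertex = V1' | V1 | V2 | V3 | V4 | V5

definition D6_edges :: "D6_vertex set set" where
  "D6_edges = {{V1, V2}, {V2, V3}, {V3, V4}, {V4, V5}, {V1', V2}}"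

definition D6_m :: "D6_vertex \<Rightarrow> D6_vertex \<Rightarrow> nat" where
  "D6_m i j = (if i = j then 1 else if {i, j} \<in> D6_edges then 3 else 2)"

definition W_D6 :: "D6_vertex word set monoid" where
  "W_D6 = coxeter_group D6_m"

definition s_D6 :: "D6_vertex \<Rightarrow> D6_vertex word set" where
  "s_D6 i = coxeter_gen D6_m i"

section \<open>The structures above are groups\<close>

lemma group_GL: "group (GL :: (real ^ 'n ^ 'n) monoid)"
proof (rule groupI)
  fix A :: "real ^ 'n ^ 'n" assume "A \<in> carrier GL"
  then obtain B where B: "A ** B = mat 1" "B ** A = mat 1"
    by (auto simp: GL_def invertible_def)
  then have "invertible B" unfolding invertible_def by blast
  with B show "\<exists>B\<in>carrier GL. B \<otimes>\<^bsub>GL\<^esub> A = \<one>\<^bsub>GL\<^esub>"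
    by (intro bexI[of _ B]) (simp_all add: GL_def)
next
  have "invertible (mat 1 :: real ^ 'n ^ 'n)"
    unfolding invertible_def by (rule exI[of _ "mat 1"]) simp
  then show "\<one>\<^bsub>GL\<^esub> \<in> carrier (GL :: (real ^ 'n ^ 'n) monoid)"
    by (simp add: GL_def)
qed (simp_all add: GL_def invertible_mult matrix_mul_assoc)

lemma word_eq_context: "word_eq R u v \<Longrightarrow> word_eq R (p @ u @ q) (p @ v @ q)"
proof (induction rule: word_eq.induct)
  case (cancel u x b v)
  show ?case using word_eq.cancel[of R "p @ u" x b "v @ q"] by simp
next
  case (relator r u v)
  then show ?case using word_eq.relator[of r R "p @ u" "v @ q"] by simp
next
  case (trans u v w)
  show ?case by (rule word_eq.trans[OF trans.IH])
qed (rule word_eq.refl, rule word_eq.sym)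

lemma word_eq_append:
  assumes "word_eq R a a'" "word_eq R b b'"
  shows "word_eq R (a @ b) (a' @ b')"
proof (rule word_eq.trans)
  show "word_eq R (a @ b) (a' @ b)"
    using word_eq_context[OF assms(1), of "[]" b] by simp
  show "word_eq R (a' @ b) (a' @ b')"
    using word_eq_context[OF assms(2), of a' "[]"] by simp
qed

lemma word_class_eq_iff: "word_class R u = word_class R v \<longleftrightarrow> word_eq R u v"
proof
  show "word_class R u = word_class R v \<Longrightarrow> word_eq R u v"
    unfolding word_class_def using word_eq.refl[of R v] by blast
  show "word_eq R u v \<Longrightarrow> word_class R u = word_class R v"
    unfolding word_class_def
    by (intro Collect_cong iffI) (rule word_eq.trans[OF word_eq.sym], assumption+,
      rule word_eq.trans, assumption+)
qed

lemma mult_word_class: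
  "word_class R u \<otimes>\<^bsub>presented_group R\<^esub> word_class R v = word_class R (u @ v)"
proof -
  have "word_class R (a @ b) = word_class R (u @ v)"
    if "a \<in> word_class R u" "b \<in> word_class R v" for a b
    using that word_eq_append[of R u a v b, THEN word_eq.sym]
    unfolding word_class_eq_iff by (simp add: word_class_def)
  moreover have "u \<in> word_class R u" "v \<in> word_class R v"
    by (auto simp: word_class_def intro: word_eq.refl)
  ultimately have "(\<Union>a\<in>word_class R u. \<Union>b\<in>word_class R v. word_class R (a @ b))
      = word_class R (u @ v)"
    by blast
  then show ?thesis by (simp add: presented_group_def)
qed

lemma inverse_word: "word_eq R (rev (map (apsnd Not) u) @ u) []"
proof (induction u)
  case (Cons a u)
  obtain x b where a: "a = (x, b)" by force
  have "word_eq R (rev (map (apsnd Not) u) @ [(x, \<not> b), (x, \<not> \<not> b)] @ u)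
      (rev (map (apsnd Not) u) @ u)"
    by (rule word_eq.cancel)
  from word_eq.trans[OF this Cons] show ?case by (simp add: a)
qed (simp add: word_eq.refl)

lemma group_presented_group: "group (presented_group R)"
proof (rule groupI)
  have carrier: "A \<in> carrier (presented_group R) \<longleftrightarrow> (\<exists>u. A = word_class R u)" for A
    by (auto simp: presented_group_def)
  have one: "\<one>\<^bsub>presented_group R\<^esub> = word_class R []"
    by (simp add: presented_group_def)
  show "A \<otimes>\<^bsub>presented_group R\<^esub> B \<in> carrier (presented_group R)"
    if "A \<in> carrier (presented_group R)" "B \<in> carrier (presented_group R)" for A B
    using that by (auto simp: carrier mult_word_class)
  show "\<one>\<^bsub>presented_group R\<^esub> \<in> carrier (presented_group R)"
    by (auto simp: carrier one)
  show "A \<otimes>\<^bsub>presented_group R\<^esub> B \<otimes>\<^bsub>presented_group R\<^esub> C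
      = A \<otimes>\<^bsub>presented_group R\<^esub> (B \<otimes>\<^bsub>presented_group R\<^esub> C)"
    if "A \<in> carrier (presented_group R)" "B \<in> carrier (presented_group R)"
      "C \<in> carrier (presented_group R)" for A B C
    using that by (auto simp: carrier mult_word_class)
  show "\<one>\<^bsub>presented_group R\<^esub> \<otimes>\<^bsub>presented_group R\<^esub> A = A"
    if "A \<in> carrier (presented_group R)" for A
    using that by (auto simp: carrier mult_word_class one)
  show "\<exists>B\<in>carrier (presented_group R). B \<otimes>\<^bsub>presented_group R\<^esub> A = \<one>\<^bsub>presented_group R\<^esub>"
    if "A \<in> carrier (presented_group R)" for A
  proof -
    from that obtain u where "A = word_class R u" by (auto simp: carrier)
    then have "word_class R (rev (map (apsnd Not) u)) \<otimes>\<^bsub>presented_group R\<^esub> A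
        = \<one>\<^bsub>presented_group R\<^esub>"
      using inverse_word by (simp add: mult_word_class one word_class_eq_iff)
    then show ?thesis
      by (rule bexI[of _ "word_class R (rev (map (apsnd Not) u))"]) (auto simp: carrier)
  qed
qed

end

(* All six generators are reflections x |-> x - (f.x) a, and the pairings of the coroots f with the
   roots a are the Cartan integers of D_6 once (12) is replaced by its conjugate s_2 s_1 (12) s_1 s_2.
   So the Coxeter relations hold and W(D_6) acts on R^7 with image M_K. The action is faithful by
   Tits' argument: if l(ws) >= l(w) for a generator s, then w sends
   the simple root of s to the positive side of a hyperplane having all simple roots on that side;
   applied to w = vt with l(w) = l(v) + 1, this shows that w cannot fix the root of t. *)

theory Submission
  imports Defs "HOL-Combinatorics.Permutations"
begin

section \<open>Faithfulness of simply laced reflection representations\<close>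

context group
begin

text \<open>A left fold, so that inductions peel letters off on the right, the side on which lengths
  are compared below.\<close>

definition gen_prod :: "('i \<Rightarrow> 'a) \<Rightarrow> 'i list \<Rightarrow> 'a" where
  "gen_prod s xs = foldl (\<lambda>g i. g \<otimes> s i) \<one> xs"

text \<open>This is the Coxeter length once the \<open>s i\<close> are generating involutions, since
  inverse letters then add nothing. Outside \<open>range (gen_prod s)\<close> the
  \<open>LEAST\<close> is unspecified, hence the range hypotheses below.\<close>

definition word_length :: "('i \<Rightarrow> 'a) \<Rightarrow> 'a \<Rightarrow> nat" where
  "word_length s w = (LEAST n. \<exists>xs. length xs = n \<and> w = gen_prod s xs)"

lemma gen_prod_Nil [simp]: "gen_prod s [] = \<one>"
  by (simp add: gen_prod_def)

lemma gen_prod_snoc [simp]: "gen_prod s (xs @ [i]) = gen_prod s xs \<otimes> s i"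
  by (simp add: gen_prod_def)

lemma gen_prod_closed [simp]:
  assumes "\<And>i. s i \<in> carrier G"
  shows "gen_prod s xs \<in> carrier G"
  by (induction xs rule: rev_induct) (simp_all add: assms)

lemma word_length_le: "word_length s (gen_prod s xs) \<le> length xs"
  unfolding word_length_def by (rule Least_le) blast

lemma word_length_witness:
  assumes "w \<in> range (gen_prod s)"
  obtains xs where "length xs = word_length s w" "w = gen_prod s xs"
proof -
  have "\<exists>xs. length xs = word_length s w \<and> w = gen_prod s xs"
    unfolding word_length_def
    by (rule LeastI_ex) (use assms in blast)
  then show ?thesis using that by blast
qed

lemma word_length_mult_gen:
  assumes "w \<in> range (gen_prod s)"
  shows "word_length s (w \<otimes> s i) \<le> Suc (word_length s w)"
proof -
  obtain xs where xs: "length xs = word_length s w" "w = gen_prod s xs"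
    using word_length_witness[OF assms] .
  have "w \<otimes> s i = gen_prod s (xs @ [i])" using xs by simp
  then show ?thesis using word_length_le[of s "xs @ [i]"] xs(1) by simp
qed

end

text \<open>The setting of Tits' argument: the simply laced Coxeter relations in \<open>G\<close>, a
  representation acting on the \<open>\<alpha> i\<close> as simple reflections act on simple roots,
  and a functional \<open>p\<close> positive on all of them.\<close>

locale simply_laced_rep = group G for G (structure) +
  fixes s :: "'i \<Rightarrow> 'a" and h :: "'a \<Rightarrow> real ^ 'n ^ 'n"
    and \<alpha> :: "'i \<Rightarrow> real ^ 'n" and p :: "real ^ 'n" and adj :: "'i \<Rightarrow> 'i \<Rightarrow> bool"
  assumes gen_closed [simp]: "s i \<in> carrier G"
    and generated: "carrier G = range (gen_prod s)"
    and involution: "s i \<otimes> s i = \<one>"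
    and commute: "i \<noteq> j \<Longrightarrow> \<not> adj i j \<Longrightarrow> s i \<otimes> s j = s j \<otimes> s i"
    and braid: "adj i j \<Longrightarrow> s i \<otimes> s j \<otimes> s i = s j \<otimes> s i \<otimes> s j"
    and hom: "h \<in> hom G GL"
    and root_neg: "h (s i) *v \<alpha> i = - \<alpha> i"
    and root_fix: "i \<noteq> j \<Longrightarrow> \<not> adj i j \<Longrightarrow> h (s i) *v \<alpha> j = \<alpha> j"
    and root_add: "adj i j \<Longrightarrow> h (s i) *v \<alpha> j = \<alpha> i + \<alpha> j"
    and adj_sym: "adj i j \<Longrightarrow> adj j i"
    and positive: "p \<bullet> \<alpha> i > 0"
begin

lemma rep_mult:
  assumes "g \<in> carrier G" "k \<in> carrier G"
  shows "h (g \<otimes> k) *v x = h g *v (h k *v x)"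
  using hom_mult[OF hom assms] by (simp add: GL_def matrix_vector_mul_assoc)

lemma rep_one: "h \<one> = mat 1"
  using hom_one[OF hom is_group group_GL] by (simp add: GL_def)

lemma mult_gen_gen: "g \<in> carrier G \<Longrightarrow> g \<otimes> s i \<otimes> s i = g"
  by (simp add: m_assoc involution)

text \<open>Dropping the last letter of a shortest word leaves a word at least one shorter, and a
  right factor \<open>s t\<close> raises the length by at most one.\<close>

lemma last_letter:
  assumes "w \<in> carrier G" "w \<noteq> \<one>"
  obtains v t where "v \<in> carrier G" "w = v \<otimes> s t" "word_length s w = Suc (word_length s v)"
proof -
  obtain xs where xs: "length xs = word_length s w" "w = gen_prod s xs"
    using word_length_witness[of w s] assms(1) by (auto simp: generated)
  have "xs \<noteq> []" using xs assms(2) by auto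
  then obtain ys t where ys: "xs = ys @ [t]" by (cases xs rule: rev_cases) auto
  let ?v = "gen_prod s ys"
  have w: "w = ?v \<otimes> s t" using xs ys by simp
  have "word_length s w \<le> Suc (word_length s ?v)"
    unfolding w by (rule word_length_mult_gen) simp
  moreover have "word_length s ?v \<le> length ys" by (rule word_length_le)
  ultimately have "word_length s w = Suc (word_length s ?v)" using xs(1) ys by simp
  moreover have "?v \<in> carrier G" by simp
  ultimately show ?thesis using that w by blast
qed

text \<open>Tits' argument. Instead of tracking positive combinations of the simple roots it suffices
  to track the sign of the functional \<open>p\<close>, which is positive on all simple roots.\<close>

lemma root_positive:
  assumes "w \<in> carrier G" "word_length s w \<le> word_length s (w \<otimes> s i)"
  shows "p \<bullet> (h w *v \<alpha> i) > 0"
  using assms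
proof (induction "word_length s w" arbitrary: w i rule: less_induct)
  case less
  note len_le = word_length_mult_gen[of _ s, folded generated]
  show ?case
  proof (cases "w = \<one>")
    case True
    then show ?thesis by (simp add: rep_one positive)
  next
    case False
    then obtain v t where v: "v \<in> carrier G" and w: "w = v \<otimes> s t"
      and len: "word_length s w = Suc (word_length s v)"
      using last_letter less.prems(1) by blast
    \<comment> \<open>Otherwise \<open>w \<otimes> s i = v\<close> would be shorter than
      \<open>w\<close>.\<close>
    have "t \<noteq> i"
      using less.prems(2) len v by (auto simp: w mult_gen_gen)
    have IH: "p \<bullet> (h u *v \<alpha> j) > 0 \<or> word_length s (u \<otimes> s j) < word_length s u"
      if "u \<in> carrier G" "word_length s u \<le> word_length s v" for u j
      using less.hyps[of u j] that len by (auto simp: not_le)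
    show ?thesis
    proof (cases "adj t i")
      case False
      have "h w *v \<alpha> i = h v *v \<alpha> i"
        using v root_fix[OF \<open>t \<noteq> i\<close> False] by (simp add: w rep_mult)
      \<comment> \<open>As \<open>s t\<close> and \<open>s i\<close> commute, a descent of
        \<open>v\<close> at \<open>i\<close> would give a descent of \<open>w\<close> at
        \<open>i\<close>.\<close>
      moreover have "\<not> word_length s (v \<otimes> s i) < word_length s v"
      proof
        assume "word_length s (v \<otimes> s i) < word_length s v"
        moreover have "w \<otimes> s i = v \<otimes> s i \<otimes> s t"
          using v commute[OF \<open>t \<noteq> i\<close> False] by (simp add: w m_assoc)
        ultimately show False
          using len_le[of "v \<otimes> s i" t] v less.prems(2) len by simp
      qed
      ultimately show ?thesis using IH[OF v] by auto
    next
      case True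
      have hw: "h w *v \<alpha> i = h v *v \<alpha> t + h v *v \<alpha> i"
        using v root_add[OF True]
        by (simp add: w rep_mult matrix_vector_right_distrib)
      have pos_t: "p \<bullet> (h v *v \<alpha> t) > 0"
        using IH[OF v, of t] len by (auto simp: w)
      show ?thesis
      proof (cases "word_length s (v \<otimes> s i) < word_length s v")
        case False
        then have "p \<bullet> (h v *v \<alpha> i) > 0" using IH[OF v, of i] by auto
        with pos_t show ?thesis by (simp add: hw inner_add_right)
      next
        case shorter: True
        \<comment> \<open>Rank-two step: \<open>w = ?u \<otimes> s i \<otimes> s t\<close>, and
          \<open>s i \<otimes> s t\<close> sends \<open>\<alpha> i\<close> to
          \<open>\<alpha> t\<close>. The claim thus passes to \<open>?u\<close> and
          \<open>t\<close>, provided that \<open>?u\<close> has no descent at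
          \<open>t\<close>.\<close>
        let ?u = "v \<otimes> s i"
        have u: "?u \<in> carrier G" using v by simp
        have v_eq: "v = ?u \<otimes> s i" using v by (simp add: mult_gen_gen)
        have "h w *v \<alpha> i = h ?u *v \<alpha> t"
          using v root_add[OF adj_sym[OF True]] by (simp add: hw rep_mult matrix_vector_right_distrib)
        moreover have "\<not> word_length s (?u \<otimes> s t) < word_length s ?u"
        proof
          assume "word_length s (?u \<otimes> s t) < word_length s ?u"
          \<comment> \<open>By the braid relation, a descent of \<open>?u\<close> at
            \<open>t\<close> bounds the length of \<open>w \<otimes> s i\<close> by that of
            \<open>?u\<close> plus one, hence by that of \<open>v\<close>.\<close>
          moreover have "w \<otimes> s i = ?u \<otimes> s t \<otimes> s i \<otimes> s t"
          proof -
            have "w \<otimes> s i = ?u \<otimes> (s i \<otimes> s t \<otimes> s i)"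
              using u v v_eq by (metis w gen_closed m_assoc m_closed)
            also have "\<dots> = ?u \<otimes> s t \<otimes> s i \<otimes> s t"
              using u braid[OF True] by (simp add: m_assoc)
            finally show ?thesis .
          qed
          ultimately show False
            using len_le[of "?u \<otimes> s t" i] len_le[of "?u \<otimes> s t \<otimes> s i" t] u v less.prems(2) len shorter
            by simp
        qed
        ultimately show ?thesis using IH[OF u, of t] shorter by auto
      qed
    qed
  qed
qed

lemma trivial_kernel:
  assumes "w \<in> carrier G" "h w = mat 1"
  shows "w = \<one>"
proof (rule ccontr)
  assume "w \<noteq> \<one>"
  then obtain v t where v: "v \<in> carrier G" and w: "w = v \<otimes> s t"
    and len: "word_length s w = Suc (word_length s v)"
    using last_letter assms(1) by blast
  have "p \<bullet> (h v *v \<alpha> t) > 0"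
    using root_positive[OF v, of t] len w by simp
  \<comment> \<open>As \<open>h (s t)\<close> negates \<open>\<alpha> t\<close>, triviality of
    \<open>h w\<close> makes \<open>h v *v \<alpha> t\<close> equal to \<open>- \<alpha> t\<close>,
    on the negative side of \<open>p\<close>.\<close>
  moreover have "\<alpha> t = h w *v \<alpha> t" by (simp add: assms)
  then have "\<alpha> t = - (h v *v \<alpha> t)"
    using v by (simp add: w rep_mult root_neg vec.neg)
  ultimately show False
    using positive[of t] by (metis inner_minus_right neg_0_less_iff_less not_less_iff_gr_or_eq)
qed

lemma faithful: "inj_on h (carrier G)"
proof -
  interpret h: group_hom G GL h
    by (simp add: group_hom_def group_hom_axioms_def group_GL hom)
  have "kernel G GL h = {\<one>}"
    using trivial_kernel rep_one by (auto simp: kernel_def GL_def)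
  then show ?thesis by (rule h.trivial_ker_imp_inj)
qed

end

section \<open>The universal property of a presented group\<close>

definition word_eval :: "('b, 'c) monoid_scheme \<Rightarrow> ('a \<Rightarrow> 'b) \<Rightarrow> 'a word \<Rightarrow> 'b" where
  "word_eval H f w = foldr (\<lambda>(x, b) y. (if b then f x else inv\<^bsub>H\<^esub> f x) \<otimes>\<^bsub>H\<^esub> y) w \<one>\<^bsub>H\<^esub>"

lemma word_eval_Nil [simp]: "word_eval H f [] = \<one>\<^bsub>H\<^esub>"
  by (simp add: word_eval_def)

lemma word_eval_Cons [simp]:
  "word_eval H f ((x, b) # w) = (if b then f x else inv\<^bsub>H\<^esub> f x) \<otimes>\<^bsub>H\<^esub> word_eval H f w"
  by (simp add: word_eval_def)

text \<open>\<open>SOME\<close> picks an arbitrary representative; the value does not depend on it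
  once \<open>f\<close> sends all relators to the identity.\<close>

definition presented_lift ::
  "('b, 'c) monoid_scheme \<Rightarrow> ('a \<Rightarrow> 'b) \<Rightarrow> 'a word set \<Rightarrow> 'b" where
  "presented_lift H f A = word_eval H f (SOME u. u \<in> A)"

context group
begin

lemma word_eval_closed:
  assumes "\<And>x. f x \<in> carrier G"
  shows "word_eval G f w \<in> carrier G"
  by (induction w) (auto simp: assms)

lemma word_eval_append:
  assumes "\<And>x. f x \<in> carrier G"
  shows "word_eval G f (u @ v) = word_eval G f u \<otimes> word_eval G f v"
  by (induction u) (auto simp: assms word_eval_closed m_assoc)

text \<open>\<open>word_eq\<close> is generated by inserting and deleting factors, each of which
  evaluates to the identity.\<close>

lemma word_eval_cong_word_eq:
  assumes f: "\<And>x. f x \<in> carrier G" and R: "\<And>r. r \<in> R \<Longrightarrow> word_eval G f r = \<one>"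
  shows "word_eq R u v \<Longrightarrow> word_eval G f u = word_eval G f v"
proof (induction rule: word_eq.induct)
  case (cancel u x b v)
  have "word_eval G f [(x, b), (x, \<not> b)] = \<one>" by (simp add: f)
  then show ?case
    by (simp only: word_eval_append[of f, OF f] l_one word_eval_closed[of f, OF f])
next
  case (relator r u v)
  then show ?case by (simp add: word_eval_append f word_eval_closed R)
qed auto

lemma presented_lift_word_class:
  assumes "\<And>x. f x \<in> carrier G" "\<And>r. r \<in> R \<Longrightarrow> word_eval G f r = \<one>"
  shows "presented_lift G f (word_class R u) = word_eval G f u"
proof -
  have "(SOME v. v \<in> word_class R u) \<in> word_class R u"
    by (rule someI[of _ u]) (simp add: word_class_def word_eq.refl)
  then show ?thesis
    using word_eval_cong_word_eq[of f R, OF assms]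
    unfolding presented_lift_def by (simp add: word_class_def)
qed

lemma presented_lift_hom:
  assumes "\<And>x. f x \<in> carrier G" "\<And>r. r \<in> R \<Longrightarrow> word_eval G f r = \<one>"
  shows "presented_lift G f \<in> hom (presented_group R) G"
proof (rule homI)
  have carrier: "carrier (presented_group R) = range (word_class R)"
    by (simp add: presented_group_def)
  note lift = presented_lift_word_class[of f R, OF assms]
  show "presented_lift G f A \<in> carrier G" if "A \<in> carrier (presented_group R)" for A
    using that by (auto simp: carrier lift word_eval_closed assms(1))
  show "presented_lift G f (A \<otimes>\<^bsub>presented_group R\<^esub> B) = presented_lift G f A \<otimes> presented_lift G f B"
    if "A \<in> carrier (presented_group R)" "B \<in> carrier (presented_group R)" for A B
    using that by (auto simp: carrier mult_word_class lift word_eval_append assms(1))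
qed

end

text \<open>Coxeter relators are powers of two-letter words; this makes them power relations in the
  group.\<close>

lemma word_class_replicate:
  "word_class R (concat (replicate n w)) = word_class R w [^]\<^bsub>presented_group R\<^esub> n"
proof -
  interpret group "presented_group R" by (rule group_presented_group)
  have closed: "word_class R u \<in> carrier (presented_group R)" for u
    by (simp add: presented_group_def)
  show ?thesis
  proof (induction n)
    case 0
    show ?case by (simp add: presented_group_def)
  next
    case (Suc n)
    then show ?case by (simp only: replicate_Suc concat.simps mult_word_class[symmetric] nat_pow_Suc2[OF closed])
  qed
qed

section \<open>Reflections\<close>

text \<open>The matrix \<open>I - a f^T\<close>, a reflection when \<open>f \<bullet> a = 2\<close>.
  Root \<open>a\<close> and coroot \<open>f\<close> are separate arguments because conjugation by
  the non-orthogonal \<open>S_mat\<close> transforms them differently.\<close>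

definition reflection :: "real ^ 'n \<Rightarrow> real ^ 'n \<Rightarrow> real ^ 'n ^ 'n" where
  "reflection a f = mat 1 - (\<chi> i j. a $ i * f $ j)"

lemma reflection_vec: "reflection a f *v x = x - (f \<bullet> x) *\<^sub>R a"
proof -
  have "(\<chi> i j. a $ i * f $ j) *v x = (f \<bullet> x) *\<^sub>R a"
    by (simp add: vec_eq_iff matrix_vector_mult_def inner_vec_def sum_distrib_left mult_ac)
  then show ?thesis by (simp add: reflection_def matrix_vector_mult_diff_rdistrib)
qed

lemma reflection_square:
  assumes "f \<bullet> a = 2"
  shows "reflection a f ** reflection a f = mat 1"
  by (simp add: matrix_eq matrix_vector_mul_assoc[symmetric] reflection_vec assms inner_diff_right)

lemma reflection_commute:
  assumes "f \<bullet> b = 0" "g \<bullet> a = 0"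
  shows "reflection a f ** reflection b g = reflection b g ** reflection a f"
  by (simp add: matrix_eq matrix_vector_mul_assoc[symmetric] reflection_vec assms inner_diff_right)

text \<open>Both sides are the reflection with root \<open>a + b\<close> and coroot
  \<open>f + g\<close>.\<close>

lemma reflection_braid:
  assumes "f \<bullet> a = 2" "g \<bullet> b = 2" "f \<bullet> b = -1" "g \<bullet> a = -1"
  shows "reflection a f ** reflection b g ** reflection a f
    = reflection b g ** reflection a f ** reflection b g"
  by (simp add: matrix_eq matrix_vector_mul_assoc[symmetric] reflection_vec assms inner_diff_right)
    (simp add: vec_eq_iff algebra_simps)

text \<open>Since \<open>f \<bullet> x = g \<bullet> (A *v x)\<close>, conjugation moves the root by
  \<open>A\<close> and the coroot by its inverse transpose; this form avoids inverting
  \<open>A\<close>.\<close>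

lemma reflection_conj:
  assumes "transpose A *v g = f" 
  shows "A ** reflection a f = reflection (A *v a) g ** A"
proof -
  have "f \<bullet> x = g \<bullet> (A *v x)" for x
    using assms by (metis dot_lmul_matrix transpose_matrix_vector)
  then show ?thesis
    by (simp add: matrix_eq matrix_vector_mul_assoc[symmetric] reflection_vec
        matrix_vector_mult_diff_distrib matrix_vector_mult_scaleR)
qed

section \<open>Permutation matrices\<close>

lemma perm_matrix_comp: "perm_matrix (\<sigma> \<circ> \<tau>) = perm_matrix \<sigma> ** perm_matrix \<tau>"
proof -
  have "(\<Sum>k\<in>UNIV. (if i = \<sigma> k then 1 else 0) * (if k = \<tau> j then 1 else 0 :: real))
      = (if i = \<sigma> (\<tau> j) then 1 else 0)" for i j
    by (simp add: if_distrib[of "\<lambda>x. _ * x"] cong: if_cong)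
  then show ?thesis
    by (simp add: perm_matrix_def matrix_matrix_mult_def vec_eq_iff)
qed

lemma perm_matrix_id: "perm_matrix id = mat 1"
  by (simp add: perm_matrix_def mat_def vec_eq_iff)

lemma perm_matrix_invertible:
  assumes "bij \<sigma>"
  shows "invertible (perm_matrix \<sigma>)"
proof -
  have "\<sigma> \<circ> Hilbert_Choice.inv \<sigma> = id" "Hilbert_Choice.inv \<sigma> \<circ> \<sigma> = id"
    using assms by (simp_all add: bij_is_inj bij_is_surj surj_iff[symmetric])
  then show ?thesis
    unfolding invertible_def
    by (intro exI[of _ "perm_matrix (Hilbert_Choice.inv \<sigma>)"]) (simp add: perm_matrix_comp[symmetric] perm_matrix_id)
qed

text \<open>Exchanging two coordinates of \<open>x\<close> subtracts \<open>x_i - x_j\<close> times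
  \<open>e_i - e_j\<close>.\<close>

lemma perm_matrix_transpose_reflection:
  assumes "i \<noteq> j"
  shows "perm_matrix (Transposition.transpose i j)
    = reflection (axis i 1 - axis j 1) (axis i 1 - axis j 1)"
  using assms
  by (auto simp: perm_matrix_def reflection_def vec_eq_iff mat_def axis_def Transposition.transpose_def)

section \<open>The matrices of the proposition as reflections\<close>

lemma exhaust_7:
  fixes x :: 7
  shows "x = 1 \<or> x = 2 \<or> x = 3 \<or> x = 4 \<or> x = 5 \<or> x = 6 \<or> x = 7"
proof (induct x)
  case (of_int z)
  \<comment> \<open>Representatives run from \<open>0\<close> to \<open>6\<close>; the numeral
    \<open>7\<close> equals \<open>0\<close> in this type.\<close>
  then have "z = 0 \<or> z = 1 \<or> z = 2 \<or> z = 3 \<or> z = 4 \<or> z = 5 \<or> z = 6" by fastforce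
  then show ?case by auto
qed

lemma UNIV_7: "UNIV = {1, 2, 3, 4, 5, 6, 7 :: 7}"
  using exhaust_7 by auto

lemma forall_7: "(\<forall>i::7. P i) \<longleftrightarrow> P 1 \<and> P 2 \<and> P 3 \<and> P 4 \<and> P 5 \<and> P 6 \<and> P 7"
  by (metis exhaust_7)

lemma sum_7: "sum f (UNIV :: 7 set) = f 1 + f 2 + f 3 + f 4 + f 5 + f 6 + f 7"
  unfolding UNIV_7 by (simp add: ac_simps)

lemma vector_7 [simp]:
  "(vector [a, b, c, d, e, f, g] :: 'a::zero ^ 7) $ 1 = a"
  "(vector [a, b, c, d, e, f, g] :: 'a::zero ^ 7) $ 2 = b"
  "(vector [a, b, c, d, e, f, g] :: 'a::zero ^ 7) $ 3 = c"
  "(vector [a, b, c, d, e, f, g] :: 'a::zero ^ 7) $ 4 = d"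
  "(vector [a, b, c, d, e, f, g] :: 'a::zero ^ 7) $ 5 = e"
  "(vector [a, b, c, d, e, f, g] :: 'a::zero ^ 7) $ 6 = f"
  "(vector [a, b, c, d, e, f, g] :: 'a::zero ^ 7) $ 7 = g"
  unfolding vector_def by simp_all

section \<open>Conjugation by \<open>S_mat\<close>\<close>

lemma S_mat_invertible: "invertible S_mat"
proof -
  \<comment> \<open>Rows 2 to 4 are the pairwise sums of coordinates 2, 3 and 4, which forces these
    to vanish; the other rows then kill the rest.\<close>
  have "x = 0" if "S_mat *v x = 0" for x
    using that
    by (simp add: vec_eq_iff matrix_vector_mult_def forall_7 sum_7 S_mat_def)
  then show ?thesis
    by (simp add: invertible_left_inverse matrix_left_invertible_ker)
qed

lemma S_mat_inv: "S_mat ** matrix_inv S_mat = mat 1" "matrix_inv S_mat ** S_mat = mat 1"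
proof -
  have "S_mat ** matrix_inv S_mat = mat 1 \<and> matrix_inv S_mat ** S_mat = mat 1"
    unfolding matrix_inv_def by (rule someI_ex[OF S_mat_invertible[unfolded invertible_def]])
  then show "S_mat ** matrix_inv S_mat = mat 1" "matrix_inv S_mat ** S_mat = mat 1"
    by blast+
qed

lemma conj_S_mult: "conj_S (A ** B) = conj_S A ** conj_S B"
proof -
  have "conj_S A ** conj_S B
      = S_mat ** A ** (matrix_inv S_mat ** S_mat) ** B ** matrix_inv S_mat"
    by (simp only: conj_S_def matrix_mul_assoc)
  then show ?thesis by (simp only: conj_S_def S_mat_inv(2) matrix_mul_rid matrix_mul_assoc)
qed

lemma conj_S_one: "conj_S (mat 1) = mat 1"
  by (simp add: conj_S_def S_mat_inv)

lemma conj_S_invertible: "invertible A \<Longrightarrow> invertible (conj_S A)"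
  unfolding invertible_def by (metis conj_S_mult conj_S_one)

text \<open>Allows a conjugate to be checked without computing the inverse of
  \<open>S_mat\<close>.\<close>

lemma conj_S_eqI: "S_mat ** A = B ** S_mat \<Longrightarrow> conj_S A = B"
  by (simp add: conj_S_def S_mat_inv(1) matrix_mul_assoc[symmetric])

text \<open>For \<open>V1, \<dots>, V5\<close> the root is \<open>S d\<close> and the coroot is \<open>d\<close> transformed by the inverse
  transpose of \<open>S\<close>, where \<open>d\<close> is a difference of consecutive basis vectors; those of \<open>V1'\<close> are
  the images of the root \<open>(1, -1, 0, \<dots>)\<close> and the coroot of the transposition \<open>(12)\<close> under \<open>V1\<close> and \<open>V2\<close>.\<close>

fun D6_root :: "D6_vertex \<Rightarrow> real ^ 7" where
  "D6_root V1' = vector [1, 0, 0, -1, 0, 0, 0]"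
| "D6_root V1 = vector [0, -1, 1, 0, 0, 0, 0]"
| "D6_root V2 = vector [0, 0, -1, 1, 0, 0, 0]"
| "D6_root V3 = vector [0, 1, 1, 0, 0, 1, 1]"
| "D6_root V4 = vector [0, 0, 0, 0, 1, -1, 0]"
| "D6_root V5 = vector [0, 0, 0, 0, 0, 1, -1]"

fun D6_coroot :: "D6_vertex \<Rightarrow> real ^ 7" where
  "D6_coroot V1' = vector [1, 0, 0, -1, 0, 0, 0]"
| "D6_coroot V1 = vector [0, -1, 1, 0, 0, 0, 0]"
| "D6_coroot V2 = vector [0, 0, -1, 1, 0, 0, 0]"
| "D6_coroot V3 = vector [0, 1, 1, 0, -1, 0, 0]"
| "D6_coroot V4 = vector [0, 0, 0, 0, 1, -1, 0]"
| "D6_coroot V5 = vector [0, 0, 0, 0, 0, 1, -1]"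

section \<open>Cartan integers and relations between the reflections\<close>

definition D6_adj :: "D6_vertex \<Rightarrow> D6_vertex \<Rightarrow> bool" where
  "D6_adj i j \<longleftrightarrow> {i, j} \<in> D6_edges"

lemma D6_adj_sym: "D6_adj i j \<Longrightarrow> D6_adj j i"
  by (simp add: D6_adj_def insert_commute)

lemma D6_adj_irrefl: "\<not> D6_adj i i"
  by (auto simp: D6_adj_def D6_edges_def)

text \<open>The Cartan matrix of type \<open>D_6\<close>, from which the Coxeter relations of the
  reflections and their action on the roots are read off.\<close>

lemma coroot_root: "D6_coroot i \<bullet> D6_root j = (if i = j then 2 else if D6_adj i j then -1 else 0)"
  by (cases i; cases j)
    (simp_all add: inner_vec_def sum_7 D6_adj_def D6_edges_def doubleton_eq_iff)

definition D6_reflection :: "D6_vertex \<Rightarrow> real ^ 7 ^ 7" where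
  "D6_reflection i = reflection (D6_root i) (D6_coroot i)"

lemma D6_reflection_square: "D6_reflection i ** D6_reflection i = mat 1"
  by (simp add: D6_reflection_def reflection_square coroot_root)

lemma D6_reflection_cancel: "A ** D6_reflection i ** D6_reflection i = A"
  by (simp add: matrix_mul_assoc[symmetric] D6_reflection_square)

lemma D6_reflection_commute:
  "i \<noteq> j \<Longrightarrow> \<not> D6_adj i j \<Longrightarrow> D6_reflection i ** D6_reflection j = D6_reflection j ** D6_reflection i"
  unfolding D6_reflection_def
  by (rule reflection_commute) (auto simp: coroot_root dest: D6_adj_sym)

lemma D6_reflection_braid:
  assumes "D6_adj i j"
  shows "D6_reflection i ** D6_reflection j ** D6_reflection i
    = D6_reflection j ** D6_reflection i ** D6_reflection j"
  unfolding D6_reflection_def using assms D6_adj_sym[OF assms] D6_adj_irrefl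
  by (intro reflection_braid) (auto simp: coroot_root)

lemma D6_reflection_closed [simp]: "D6_reflection i \<in> carrier GL"
  using D6_reflection_square by (auto simp: GL_def invertible_def)

lemma swap_S_reflection:
  assumes "i \<noteq> j" "S_mat *v (axis i 1 - axis j 1) = a"
    "transpose S_mat *v f = axis i 1 - axis j 1"
  shows "swap_S i j = reflection a f"
  unfolding swap_S_def swap_matrix_def perm_matrix_transpose_reflection[OF assms(1)]
  using reflection_conj[OF assms(3)] assms(2) by (intro conj_S_eqI) simp

lemma swap_S_D6:
  "swap_S 2 3 = D6_reflection V1" "swap_S 3 4 = D6_reflection V2"
  "swap_S 4 5 = D6_reflection V3" "swap_S 5 6 = D6_reflection V4"
  "swap_S 6 7 = D6_reflection V5"
  unfolding D6_reflection_def
  by (rule swap_S_reflection;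
      simp add: vec_eq_iff forall_7 matrix_vector_mult_def sum_7 S_mat_def axis_def
        Finite_Cartesian_Product.transpose_def)+

text \<open>The reflections of \<open>V1\<close>, \<open>V2\<close>, \<open>V1'\<close> are the
  coordinate transpositions (23), (34), (14), and (12) = (23)(34)(14)(34)(23).\<close>

lemma swap_12_D6:
  "swap_matrix 1 2 = D6_reflection V1 ** D6_reflection V2 ** D6_reflection V1'
    ** D6_reflection V2 ** D6_reflection V1" (is "_ = ?R")
proof -
  have "swap_matrix 1 2 = reflection (vector [1, -1, 0, 0, 0, 0, 0]) (vector [1, -1, 0, 0, 0, 0, 0])"
  proof -
    have "axis 1 1 - axis 2 1 = (vector [1, -1, 0, 0, 0, 0, 0] :: real ^ 7)"
      by (simp add: vec_eq_iff forall_7 axis_def)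
    then show ?thesis by (simp add: swap_matrix_def perm_matrix_transpose_reflection)
  qed
  also have "\<dots> = ?R"
    by (simp add: matrix_eq matrix_vector_mul_assoc[symmetric] reflection_vec D6_reflection_def)
      (simp add: vec_eq_iff forall_7 inner_vec_def sum_7 algebra_simps)
  finally show ?thesis .
qed

section \<open>Generation by adjacent transpositions\<close>

lemma swap_S_conj:
  assumes "a \<noteq> b" "b \<noteq> c" "a \<noteq> c"
  shows "swap_S a c = swap_S a b ** swap_S b c ** swap_S a b"
proof -
  have "Transposition.transpose a c
      = Transposition.transpose a b \<circ> Transposition.transpose b c \<circ> Transposition.transpose a b"
    using assms by (auto simp: fun_eq_iff Transposition.transpose_def)
  then show ?thesis
    by (simp only: swap_S_def swap_matrix_def perm_matrix_comp conj_S_mult)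
qed

lemma swap_S_commute: "swap_S a b = swap_S b a"
  by (simp add: swap_S_def swap_matrix_def Transposition.transpose_commute)

lemma swap_S_refl: "swap_S a a = mat 1"
  by (simp add: swap_S_def swap_matrix_def perm_matrix_id conj_S_one)

abbreviation (input) MK_gens :: "(real ^ 7 ^ 7) set" where
  "MK_gens \<equiv> {swap_S 2 3, swap_S 3 4, swap_S 4 5, swap_S 5 6, swap_S 6 7, swap_matrix 1 2}"

text \<open>From (ac) = (ab)(bc)(ab). Including the degenerate cases makes membership of
  \<open>swap_S a b\<close> in \<open>H\<close> an equivalence relation on indices.\<close>

lemma swap_S_trans:
  assumes H: "subgroup H GL" and "swap_S a b \<in> H" "swap_S b c \<in> H"
  shows "swap_S a c \<in> H"
proof (cases "a = b \<or> b = c \<or> a = c")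
  case True
  then show ?thesis
    using assms subgroup.one_closed[OF H] by (auto simp: swap_S_refl GL_def)
next
  case False
  then show ?thesis
    using swap_S_conj[of a b c] assms subgroup.m_closed[OF H] by (auto simp: GL_def)
qed

text \<open>The chain of adjacent transpositions links every index other than \<open>1\<close> to
  \<open>2\<close>.\<close>

lemma swap_S_mem:
  assumes H: "subgroup H GL"
    and adjacent: "swap_S 2 3 \<in> H" "swap_S 3 4 \<in> H" "swap_S 4 5 \<in> H" "swap_S 5 6 \<in> H" "swap_S 6 7 \<in> H"
    and "a \<noteq> 1" "b \<noteq> 1"
  shows "swap_S a b \<in> H"
proof -
  note trans = swap_S_trans[OF H]
  have "swap_S 2 2 \<in> H" using subgroup.one_closed[OF H] by (simp add: swap_S_refl GL_def)
  moreover have "swap_S 2 4 \<in> H" using trans adjacent by blast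
  moreover then have "swap_S 2 5 \<in> H" using trans adjacent by blast
  moreover then have "swap_S 2 6 \<in> H" using trans adjacent by blast
  moreover then have "swap_S 2 7 \<in> H" using trans adjacent by blast
  ultimately have from_2: "swap_S 2 c \<in> H" if "c \<noteq> 1" for c
    using exhaust_7[of c] that adjacent(1) by auto
  show ?thesis
    using trans[of a 2 b] from_2 assms(7,8) swap_S_commute[of a 2] by metis
qed

text \<open>Permutations of the other six indices are products of transpositions among them.\<close>

lemma conj_S_perm_mem:
  assumes H: "subgroup H GL"
    and adjacent: "swap_S 2 3 \<in> H" "swap_S 3 4 \<in> H" "swap_S 4 5 \<in> H" "swap_S 5 6 \<in> H" "swap_S 6 7 \<in> H"
    and "\<sigma> permutes - {1}"
  shows "conj_S (perm_matrix \<sigma>) \<in> H"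
  using \<open>\<sigma> permutes - {1}\<close> finite
proof (induction rule: permutes_induct)
  case id
  then show ?case
    using subgroup.one_closed[OF H] by (simp only: perm_matrix_id conj_S_one) (simp add: GL_def)
next
  case (swap a b \<sigma>)
  have "swap_S a b \<in> H" using swap_S_mem[OF H adjacent] swap by simp
  then show ?case
    using subgroup.m_closed[OF H _ swap.IH]
    by (simp only: perm_matrix_comp conj_S_mult) (simp add: swap_S_def swap_matrix_def GL_def)
qed

lemma swap_matrix_closed: "swap_matrix i j \<in> carrier GL"
  by (simp add: swap_matrix_def GL_def perm_matrix_invertible)

lemma swap_S_closed: "swap_S i j \<in> carrier GL"
  using swap_matrix_closed[of i j] by (simp add: GL_def swap_S_def conj_S_invertible)

lemma G_K_closed: "G_K \<subseteq> carrier GL"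
  by (auto simp: G_K_def P_1_6_def GL_def intro!: conj_S_invertible perm_matrix_invertible)

lemma swap_S_mem_G_K:
  assumes "a \<noteq> 1" "b \<noteq> 1"
  shows "swap_S a b \<in> G_K"
proof -
  have "Transposition.transpose a b 1 = 1" using assms by simp
  then have "perm_matrix (Transposition.transpose a b) \<in> P_1_6"
    unfolding P_1_6_def
    by (intro CollectI exI[of _ "Transposition.transpose a b"] conjI HOL.refl bij_transpose)
  then show ?thesis unfolding G_K_def swap_S_def swap_matrix_def by (rule imageI)
qed

lemma subgroup_M_K: "subgroup M_K GL"
proof -
  have "G_K \<union> {swap_matrix 1 2} \<subseteq> carrier GL"
    using G_K_closed swap_matrix_closed by blast
  then show ?thesis
    unfolding M_K_def by (rule group.generate_is_subgroup[OF group_GL])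
qed

lemma generate_MK_gens: "generate GL MK_gens = M_K"
proof
  interpret GL: group "GL :: (real ^ 7 ^ 7) monoid" by (rule group_GL)
  have gens: "MK_gens \<subseteq> carrier GL" by (simp add: swap_S_closed swap_matrix_closed)
  show "generate GL MK_gens \<subseteq> M_K"
    unfolding M_K_def by (rule GL.mono_generate) (simp add: swap_S_mem_G_K)
  let ?H = "generate GL MK_gens"
  have H: "subgroup ?H GL" using gens by (rule GL.generate_is_subgroup)
  have "swap_S 2 3 \<in> ?H" "swap_S 3 4 \<in> ?H" "swap_S 4 5 \<in> ?H" "swap_S 5 6 \<in> ?H" "swap_S 6 7 \<in> ?H"
    and "swap_matrix 1 2 \<in> ?H"
    by (rule generate.incl; simp)+
  \<comment> \<open>Translates the condition defining \<open>P_1_6\<close> into the form used for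
    induction over transpositions.\<close>
  moreover have "\<sigma> permutes - {1}" if "bij \<sigma>" "\<sigma> 1 = 1" for \<sigma> :: "7 \<Rightarrow> 7"
    using that by (auto simp: permutes_def bij_iff)
  ultimately have "G_K \<union> {swap_matrix 1 2} \<subseteq> ?H"
    using conj_S_perm_mem[OF H] by (auto simp: G_K_def P_1_6_def)
  then show "M_K \<subseteq> ?H"
    unfolding M_K_def using H by (rule GL.generate_subgroup_incl)
qed

section \<open>The isomorphism\<close>

lemma W_D6_def': "W_D6 = presented_group (coxeter_relators D6_m)"
  by (simp add: W_D6_def coxeter_group_def)

lemma s_D6_word_class: "s_D6 i = word_class (coxeter_relators D6_m) [(i, True)]"
  by (simp add: s_D6_def coxeter_gen_def)

lemma group_W_D6: "group W_D6"
  by (simp add: W_D6_def' group_presented_group)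

lemma s_D6_closed [simp]: "s_D6 i \<in> carrier W_D6"
  by (simp add: W_D6_def' s_D6_word_class presented_group_def)

lemma D6_m_eq: "D6_m i j = (if i = j then 1 else if D6_adj i j then 3 else 2)"
  by (simp add: D6_m_def D6_adj_def)

lemma s_D6_relation: "(s_D6 i \<otimes>\<^bsub>W_D6\<^esub> s_D6 j) [^]\<^bsub>W_D6\<^esub> D6_m i j = \<one>\<^bsub>W_D6\<^esub>"
proof -
  let ?R = "coxeter_relators D6_m"
  let ?r = "concat (replicate (D6_m i j) [(i, True), (j, True)])"
  have "?r \<in> ?R" by (auto simp: coxeter_relators_def)
  from word_eq.relator[OF this, of "[]" "[]"] have "word_class ?R ?r = word_class ?R []"
    by (simp add: word_class_eq_iff)
  then have "word_class ?R [(i, True), (j, True)] [^]\<^bsub>presented_group ?R\<^esub> D6_m i j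
      = \<one>\<^bsub>presented_group ?R\<^esub>"
    unfolding word_class_replicate by (simp add: presented_group_def)
  then show ?thesis
    by (simp add: W_D6_def' s_D6_word_class mult_word_class)
qed

text \<open>All of \<open>a\<close>, \<open>b\<close> and \<open>a \<otimes> b\<close> are their own
  inverses.\<close>

lemma (in group) commute_if_square:
  assumes "a \<in> carrier G" "b \<in> carrier G" "a \<otimes> a = \<one>" "b \<otimes> b = \<one>" "(a \<otimes> b) [^] (2::nat) = \<one>"
  shows "a \<otimes> b = b \<otimes> a"
proof -
  have "inv a = a" "inv b = b" using assms(1-4) by (simp_all add: inv_equality)
  moreover have "(a \<otimes> b) \<otimes> (a \<otimes> b) = \<one>"
    using assms by (simp add: numeral_2_eq_2)
  then have "inv (a \<otimes> b) = a \<otimes> b" using assms(1,2) by (simp add: inv_equality)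
  ultimately show ?thesis using assms(1,2) by (simp add: inv_mult_group)
qed

text \<open>The product of the two sides is the cube of \<open>a \<otimes> b\<close>, and the right
  side is its own inverse.\<close>

lemma (in group) braid_if_cube:
  assumes "a \<in> carrier G" "b \<in> carrier G" "a \<otimes> a = \<one>" "b \<otimes> b = \<one>" "(a \<otimes> b) [^] (3::nat) = \<one>"
  shows "a \<otimes> b \<otimes> a = b \<otimes> a \<otimes> b"
proof -
  have "inv a = a" "inv b = b" using assms(1-4) by (simp_all add: inv_equality)
  moreover have "(a \<otimes> b \<otimes> a) \<otimes> (b \<otimes> a \<otimes> b) = \<one>"
    using assms by (simp add: numeral_3_eq_3 m_assoc)
  then have "inv (b \<otimes> a \<otimes> b) = a \<otimes> b \<otimes> a" using assms(1,2) by (simp add: inv_equality)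
  ultimately show ?thesis using assms(1,2) by (simp add: inv_mult_group m_assoc)
qed

text \<open>The relator with \<open>D6_m i i = 1\<close> is the square of a single
  generator.\<close>

lemma s_D6_involution: "s_D6 i \<otimes>\<^bsub>W_D6\<^esub> s_D6 i = \<one>\<^bsub>W_D6\<^esub>"
proof -
  interpret group W_D6 by (rule group_W_D6)
  show ?thesis using s_D6_relation[of i i] by (simp add: D6_m_eq)
qed

lemma D6_relator_eval:
  assumes "r \<in> coxeter_relators D6_m"
  shows "word_eval GL D6_reflection r = \<one>\<^bsub>GL\<^esub>"
proof -
  obtain i j where r: "r = concat (replicate (D6_m i j) [(i, True), (j, True)])"
    using assms by (auto simp: coxeter_relators_def)
  let ?a = "D6_reflection i" and ?b = "D6_reflection j"
  note sq = D6_reflection_square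
  consider "i = j" | "i \<noteq> j" "\<not> D6_adj i j" | "i \<noteq> j" "D6_adj i j" by blast
  then show ?thesis
  proof cases
    case 1
    then show ?thesis by (simp add: r D6_m_eq GL_def sq)
  next
    case 2
    have "?a ** (?b ** (?a ** ?b)) = ?a ** (?b ** ?b) ** ?a"
      by (metis D6_reflection_commute[OF 2] matrix_mul_assoc)
    then show ?thesis using 2 by (simp add: r D6_m_eq numeral_2_eq_2 GL_def sq)
  next
    case 3
    have "?a ** (?b ** (?a ** (?b ** (?a ** ?b)))) = (?a ** ?b ** ?a) ** (?b ** ?a ** ?b)"
      by (simp only: matrix_mul_assoc)
    \<comment> \<open>The braid relation makes the two factors equal, and their product cancels from
      the middle outwards.\<close>
    also have "\<dots> = mat 1"
      by (simp only: D6_reflection_braid[OF 3(2)] matrix_mul_assoc D6_reflection_cancel sq)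
    finally show ?thesis using 3 by (simp add: r D6_m_eq numeral_3_eq_3 GL_def sq)
  qed
qed

section \<open>The reflection representation and its faithfulness\<close>

definition D6_rep :: "D6_vertex word set \<Rightarrow> real ^ 7 ^ 7" where
  "D6_rep = presented_lift GL D6_reflection"

lemma D6_rep_hom: "D6_rep \<in> hom W_D6 GL"
  unfolding D6_rep_def W_D6_def'
  by (rule group.presented_lift_hom[OF group_GL]) (simp_all add: D6_relator_eval)

lemma D6_rep_gen: "D6_rep (s_D6 i) = D6_reflection i"
  unfolding D6_rep_def s_D6_word_class
  by (subst group.presented_lift_word_class[OF group_GL]) (simp_all add: D6_relator_eval, simp add: GL_def)

text \<open>The letter \<open>(x, False)\<close> stands for the inverse of an involution, hence for
  \<open>s_D6 x\<close> itself, so words in positive letters suffice.\<close>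

lemma W_D6_generated: "carrier W_D6 = range (group.gen_prod W_D6 s_D6)"
proof -
  interpret group W_D6 by (rule group_W_D6)
  have "word_class (coxeter_relators D6_m) u \<in> range (gen_prod s_D6)" for u
  proof (induction u rule: rev_induct)
    case Nil
    then show ?case
      using gen_prod_Nil[of s_D6] unfolding W_D6_def' by (auto simp: presented_group_def intro: range_eqI)
  next
    case (snoc l u)
    let ?C = "word_class (coxeter_relators D6_m)"
    obtain x b where l: "l = (x, b)" by force
    have "?C [(x, False)] \<otimes>\<^bsub>W_D6\<^esub> s_D6 x = \<one>\<^bsub>W_D6\<^esub>"
      using word_eq.cancel[of "coxeter_relators D6_m" "[]" x False "[]"]
      by (simp add: W_D6_def' s_D6_word_class mult_word_class)
        (simp add: presented_group_def word_class_eq_iff)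
    moreover have "?C [(x, False)] \<in> carrier W_D6" by (simp add: W_D6_def' presented_group_def)
    ultimately have "?C [(x, False)] = s_D6 x"
      using s_D6_involution[of x] right_cancel s_D6_closed by metis
    then have "?C [l] = s_D6 x" by (cases b) (simp_all add: l s_D6_word_class)
    moreover have "?C (u @ [l]) = ?C u \<otimes>\<^bsub>W_D6\<^esub> ?C [l]" by (simp add: W_D6_def' mult_word_class)
    moreover obtain xs where "?C u = gen_prod s_D6 xs" using snoc by blast
    ultimately have "?C (u @ [l]) = gen_prod s_D6 (xs @ [x])" by simp
    then show ?case by blast
  qed
  moreover have "gen_prod s_D6 xs \<in> carrier W_D6" for xs by simp
  ultimately show ?thesis by (auto simp: W_D6_def' presented_group_def)
qed

text \<open>The functional in the following proof takes the value \<open>2\<close> on every simple root.\<close>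

lemma D6_rep_inj: "inj_on D6_rep (carrier W_D6)"
proof -
  interpret group W_D6 by (rule group_W_D6)
  interpret simply_laced_rep W_D6 s_D6 D6_rep D6_root "vector [6, 0, 2, 4, 3, 1, -1]" D6_adj
  proof
    fix i j
    show "s_D6 i \<in> carrier W_D6" by simp
    show "carrier W_D6 = range (gen_prod s_D6)" by (rule W_D6_generated)
    show "s_D6 i \<otimes>\<^bsub>W_D6\<^esub> s_D6 i = \<one>\<^bsub>W_D6\<^esub>" by (rule s_D6_involution)
    show "D6_rep \<in> hom W_D6 GL" by (rule D6_rep_hom)
    show "D6_rep (s_D6 i) *v D6_root i = - D6_root i"
      by (simp add: D6_rep_gen D6_reflection_def reflection_vec coroot_root scaleR_2)
    show "vector [6, 0, 2, 4, 3, 1, -1] \<bullet> D6_root i > 0"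
      by (cases i) (simp_all add: inner_vec_def sum_7)
    show "s_D6 i \<otimes>\<^bsub>W_D6\<^esub> s_D6 j = s_D6 j \<otimes>\<^bsub>W_D6\<^esub> s_D6 i" if "i \<noteq> j" "\<not> D6_adj i j"
      using that s_D6_relation[of i j] by (intro commute_if_square) (simp_all add: s_D6_involution D6_m_eq)
    show "D6_rep (s_D6 i) *v D6_root j = D6_root j" if "i \<noteq> j" "\<not> D6_adj i j"
      using that by (simp add: D6_rep_gen D6_reflection_def reflection_vec coroot_root)
    assume adj: "D6_adj i j"
    then have "i \<noteq> j" using D6_adj_irrefl by blast
    then show "s_D6 i \<otimes>\<^bsub>W_D6\<^esub> s_D6 j \<otimes>\<^bsub>W_D6\<^esub> s_D6 i = s_D6 j \<otimes>\<^bsub>W_D6\<^esub> s_D6 i \<otimes>\<^bsub>W_D6\<^esub> s_D6 j"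
      using adj s_D6_relation[of i j] by (intro braid_if_cube) (simp_all add: s_D6_involution D6_m_eq)
    show "D6_rep (s_D6 i) *v D6_root j = D6_root i + D6_root j"
      using adj \<open>i \<noteq> j\<close> by (simp add: D6_rep_gen D6_reflection_def reflection_vec coroot_root)
    show "D6_adj j i" using adj by (rule D6_adj_sym)
  qed
  show ?thesis by (rule faithful)
qed

section \<open>The image of the representation\<close>

lemma D6_reflection_in_M_K: "D6_reflection i \<in> M_K"
proof -
  have mult: "A ** B \<in> M_K" if "A \<in> M_K" "B \<in> M_K" for A B
    using subgroup.m_closed[OF subgroup_M_K that] by (simp add: GL_def)
  have "swap_S 2 3 \<in> M_K" "swap_S 3 4 \<in> M_K" "swap_S 4 5 \<in> M_K" "swap_S 5 6 \<in> M_K" "swap_S 6 7 \<in> M_K"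
    and "swap_matrix 1 2 \<in> M_K"
    unfolding generate_MK_gens[symmetric] by (rule generate.incl; simp)+
  note gens = this[unfolded swap_S_D6]
  let ?a = "D6_reflection V1" and ?b = "D6_reflection V2" and ?c = "D6_reflection V1'"
  \<comment> \<open>This solves \<open>swap_12_D6\<close> for the reflection of \<open>V1'\<close>,
    which is not itself among the generators of \<open>M_K\<close>.\<close>
  have "?b ** ?a ** swap_matrix 1 2 ** ?a ** ?b = ?c"
    by (simp only: swap_12_D6 matrix_mul_assoc D6_reflection_cancel D6_reflection_square matrix_mul_lid)
  then have "?c \<in> M_K" using gens mult by metis
  with gens show ?thesis by (cases i) auto
qed

lemma D6_rep_image: "D6_rep ` carrier W_D6 = M_K"
proof
  interpret W: group W_D6 by (rule group_W_D6)
  interpret GL: group "GL :: (real ^ 7 ^ 7) monoid" by (rule group_GL)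
  interpret h: group_hom W_D6 GL D6_rep
    by (simp add: group_hom_def group_hom_axioms_def group_GL group_W_D6 D6_rep_hom)
  have "D6_rep (W.gen_prod s_D6 xs) \<in> M_K" for xs
  proof (induction xs rule: rev_induct)
    case Nil
    then show ?case using subgroup.one_closed[OF subgroup_M_K] by simp
  next
    case (snoc x xs)
    then show ?case
      using subgroup.m_closed[OF subgroup_M_K snoc D6_reflection_in_M_K] by (simp add: D6_rep_gen)
  qed
  then show "D6_rep ` carrier W_D6 \<subseteq> M_K" unfolding W_D6_generated by blast
  have "D6_reflection i \<in> D6_rep ` carrier W_D6" for i
    using D6_rep_gen[of i] s_D6_closed by (metis imageI)
  moreover from this have "swap_matrix 1 2 \<in> D6_rep ` carrier W_D6"
    unfolding swap_12_D6 using subgroup.m_closed[OF h.img_is_subgroup] by (simp add: GL_def)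
  ultimately have "MK_gens \<subseteq> D6_rep ` carrier W_D6"
    by (simp add: swap_S_D6)
  then show "M_K \<subseteq> D6_rep ` carrier W_D6"
    unfolding generate_MK_gens[symmetric]
    using h.img_is_subgroup by (rule GL.generate_subgroup_incl)
qed

theorem proposition4p9:
  shows "generate GL {swap_S 2 3, swap_S 3 4, swap_S 4 5, swap_S 5 6, swap_S 6 7, swap_matrix 1 2}
      = M_K
    \<and> (\<exists>\<phi> \<in> iso (GL\<lparr>carrier := M_K\<rparr>) W_D6.
        \<phi> (swap_S 2 3) = s_D6 V1 \<and>
        \<phi> (swap_S 3 4) = s_D6 V2 \<and>
        \<phi> (swap_S 4 5) = s_D6 V3 \<and>
        \<phi> (swap_S 5 6) = s_D6 V4 \<and>
        \<phi> (swap_S 6 7) = s_D6 V5 \<and>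
        \<phi> (swap_matrix 1 2)
          = s_D6 V1 \<otimes>\<^bsub>W_D6\<^esub> s_D6 V2 \<otimes>\<^bsub>W_D6\<^esub> s_D6 V1' \<otimes>\<^bsub>W_D6\<^esub> s_D6 V2 \<otimes>\<^bsub>W_D6\<^esub> s_D6 V1)"
proof -
  interpret W: group W_D6 by (rule group_W_D6)
  \<comment> \<open>The isomorphism runs from matrices to \<open>W_D6\<close>, so it is the inverse
    of the faithful representation.\<close>
  let ?\<phi> = "inv_into (carrier W_D6) D6_rep"
  have mult: "D6_rep (A \<otimes>\<^bsub>W_D6\<^esub> B) = D6_rep A ** D6_rep B"
    if "A \<in> carrier W_D6" "B \<in> carrier W_D6" for A B
    using hom_mult[OF D6_rep_hom that] by (simp add: GL_def)
  have "D6_rep \<in> iso W_D6 (GL\<lparr>carrier := M_K\<rparr>)"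
    using D6_rep_inj D6_rep_image D6_rep_hom by (auto simp: iso_def hom_def bij_betw_def)
  then have "?\<phi> \<in> iso (GL\<lparr>carrier := M_K\<rparr>) W_D6" by (rule W.iso_set_sym)
  moreover have inverse: "?\<phi> (D6_rep A) = A" if "A \<in> carrier W_D6" for A
    using D6_rep_inj that by (rule inv_into_f_f)
  then have "?\<phi> (D6_reflection i) = s_D6 i" for i
    using D6_rep_gen[of i] by (metis s_D6_closed)
  moreover have "swap_matrix 1 2 = D6_rep (s_D6 V1 \<otimes>\<^bsub>W_D6\<^esub> s_D6 V2 \<otimes>\<^bsub>W_D6\<^esub> s_D6 V1'
      \<otimes>\<^bsub>W_D6\<^esub> s_D6 V2 \<otimes>\<^bsub>W_D6\<^esub> s_D6 V1)"
    by (simp add: swap_12_D6 mult D6_rep_gen)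
  ultimately show ?thesis
    by (intro conjI generate_MK_gens bexI[of _ ?\<phi>]) (simp_all add: swap_S_D6 inverse)
qed

end
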